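(* Let $A$ be a triassociative algebra over a field $K$ and let $M$ be an $A$-representation. The maps $\delta^n_i\colon C^n_{\mathrm{Trias}}(A,M)\to C^{n+1}_{\mathrm{Trias}}(A,M)$ satisfy the cosimplicial identities $$\delta^{n+1}_j\,\delta^n_i=\delta^{n+1}_i\,\delta^n_{j-1}$$ for $n \ge 0$ and $0\le i<j\le n+2$. In particular, $(C^*_{\mathrm{Trias}}(A,M),\delta)$, where $\delta^n=\sum_{i=0}^{n+1}(-1)^i\delta^n_i$, is a cochain complex.
   Context: All vector spaces and tensor products are over a fixed field $K$. A triassociative algebra is a vector space $A$ with three bilinear operations $\dashv,\vdash,\bot$ satisfying for all $x,y,z$: (1) $(x\dashv y)\dashv z=x\dashv(y\dashv z)$; (2) $(x\dashv y)\dashv z=x\dashv(y\vdash z)$; (3) $(x\vdash y)\dashv z=x\vdash(y\dashv z)$; (4) $(x\dashv y)\vdash z=x\vdash(y\vdash z)$; (5) $(x\vdash y)\vdash z=x\vdash(y\vdash z)$; (6) $(x\dashv y)\dashv z=x\dashv(y\,\bot\, z)$; (7) $(x\,\bot\, y)\dashv z=x\,\bot\,(y\dashv z)$; (8) $(x\dashv y)\,\bot\, z=x\,\bot\,(y\vdash z)$; (9) $(x\vdash y)\,\bot\, z=x\vdash(y\,\bot\, z)$; (10) $(x\,\bot\, y)\vdash z=x\vdash(y\vdash z)$; (11) $(x\,\bot\, y)\,\bot\, z=x\,\bot\,(y\,\bot\, z)$. An $A$-representation is a vector space $M$ with bilinear left operations $\dashv,\vdash,\bot\colon A\otimes M\to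 M$ and right operations $\dashv,\vdash,\bot\colon M\otimes A\to M$ satisfying (1)-(11) whenever exactly one of $x,y,z$ is from $M$ and the other two are from $A$. Trees. $T_n$ ($n\ge0$) is the set of planar rooted trees with $n+1$ leaves in which every internal vertex has at least $2$ incoming edges ($T_0=\{|\}$, no internal vertex); $\psi\in T_n$ has degree $|\psi|=n$; leaves are numbered $0,\dots,n$ from left to right. The grafting $\psi_0\vee\cdots\vee\psi_k$ is obtained by arranging the trees from left to right and joining their roots to a new lowest internal vertex, connected to a new root; every tree of degree $\ge 1$ is uniquely of this form with $k\ge1$. A leaf is left (resp. right) oriented if it is the leftmost (resp. rightmost) incoming edge of the vertex it is attached to; otherwise it is a middle leaf. $d_i\colon T_{n+1}\to T_n$ deletes the $i$th leaf (suppressing any vertex left with one incoming edge). For $\psi=\psi_0\vee\cdots\vee\psi_k\in T_{n+1}$ and $0\le i\le n+1$ define $\circ_i^\psi\in\{\dashv,\vdash,\bot\}$ by: $\circ_0^\psi$ is $\dashv$ if $|\psi_0|=0$ and $k=1$; $\vdash$ if $|\psi_0|>0$; $\bot$ if $|\psi_0|=0$ and $k>1$. For $1\le i\le n$, $\circ_i^\psi$ is $\dashv$, $\vdash$, or $\bot$ according as the $i$th leaf is left oriented, right oriented, or a middle leaf. $\circ_{n+1}^\psi$ is $\dashv$ if $|\psi_k|>0$; $\vdash$ if $k=1$ and $|\psi_1|=0$; $\bot$ if $k>1$ and $|\psi_k|=0$. Cochains. $C^n_{\mathrm{Trias}}(A,M)=\mathrm{Hom}_K(K[T_n]\otimes A^{\otimes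 n},M)$ for $n\ge 0$, and for $\psi\in T_{n+1}$, $a_1,\dots,a_{n+1}\in A$: $(\delta_0^nf)(\psi;a_1,\dots,a_{n+1})=a_1\circ_0^\psi f(d_0\psi;a_2,\dots,a_{n+1})$; $(\delta_i^nf)(\psi;a_1,\dots,a_{n+1})=f(d_i\psi;a_1,\dots,a_i\circ_i^\psi a_{i+1},\dots,a_{n+1})$ for $1\le i\le n$; $(\delta_{n+1}^nf)(\psi;a_1,\dots,a_{n+1})=f(d_{n+1}\psi;a_1,\dots,a_n)\circ_{n+1}^\psi a_{n+1}$. *)

theory Defs
  imports Complex_Main "HOL-Library.Function_Algebras"
begin

section \<open>Triassociative algebras and representations\<close>

text \<open>The names of the three operations \<open>\<stileturn>\<close>, \<open>\<turnstile>\<close>, \<open>\<bottom>\<close>. A triple of operations is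
  encoded as one function on this type.\<close>

datatype trias_op = Dashv | Vdash | Bot

text \<open>The eleven axioms for \<open>x\<close>, \<open>y\<close>, \<open>z\<close> of possibly different types. The four families of
  operations are those used to form \<open>x\<cdot>y\<close>, \<open>(x\<cdot>y)\<cdot>z\<close>, \<open>y\<cdot>z\<close> and \<open>x\<cdot>(y\<cdot>z)\<close>
  respectively, so that the same list serves for algebras and for representations.\<close>

definition trias_axioms ::
  "(trias_op \<Rightarrow> 'x \<Rightarrow> 'y \<Rightarrow> 'xy) \<Rightarrow> (trias_op \<Rightarrow> 'xy \<Rightarrow> 'z \<Rightarrow> 'w) \<Rightarrow>
   (trias_op \<Rightarrow> 'y \<Rightarrow> 'z \<Rightarrow> 'yz) \<Rightarrow> (trias_op \<Rightarrow> 'x \<Rightarrow> 'yz \<Rightarrow> 'w) \<Rightarrow> bool"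
where
  "trias_axioms xy xy_z yz x_yz \<longleftrightarrow> (\<forall>x y z.
     xy_z Dashv (xy Dashv x y) z = x_yz Dashv x (yz Dashv y z) \<and>
     xy_z Dashv (xy Dashv x y) z = x_yz Dashv x (yz Vdash y z) \<and>
     xy_z Dashv (xy Vdash x y) z = x_yz Vdash x (yz Dashv y z) \<and>
     xy_z Vdash (xy Dashv x y) z = x_yz Vdash x (yz Vdash y z) \<and>
     xy_z Vdash (xy Vdash x y) z = x_yz Vdash x (yz Vdash y z) \<and>
     xy_z Dashv (xy Dashv x y) z = x_yz Dashv x (yz Bot y z) \<and>
     xy_z Dashv (xy Bot x y) z = x_yz Bot x (yz Dashv y z) \<and>
     xy_z Bot (xy Dashv x y) z = x_yz Bot x (yz Vdash y z) \<and>
     xy_z Bot (xy Vdash x y) z = x_yz Vdash x (yz Bot y z) \<and>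
     xy_z Vdash (xy Bot x y) z = x_yz Vdash x (yz Vdash y z) \<and>
     xy_z Bot (xy Bot x y) z = x_yz Bot x (yz Bot y z))"

definition bilinear_map ::
  "('k::field \<Rightarrow> 'a::ab_group_add \<Rightarrow> 'a) \<Rightarrow> ('k \<Rightarrow> 'b::ab_group_add \<Rightarrow> 'b) \<Rightarrow>
   ('k \<Rightarrow> 'c::ab_group_add \<Rightarrow> 'c) \<Rightarrow> ('a \<Rightarrow> 'b \<Rightarrow> 'c) \<Rightarrow> bool"
where
  "bilinear_map s1 s2 s3 f \<longleftrightarrow>
     (\<forall>x. Vector_Spaces.linear s2 s3 (\<lambda>y. f x y)) \<and>
     (\<forall>y. Vector_Spaces.linear s1 s3 (\<lambda>x. f x y))"

locale triassociative_algebra = vector_space sA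
  for sA :: "'k::field \<Rightarrow> 'a::ab_group_add \<Rightarrow> 'a" +
  fixes p :: "trias_op \<Rightarrow> 'a \<Rightarrow> 'a \<Rightarrow> 'a"
  assumes mult_bilinear: "\<And>c. bilinear_map sA sA sA (p c)"
    and mult_axioms: "trias_axioms p p p p"

text \<open>\<open>l\<close> are the left operations \<open>A \<otimes> M \<rightarrow> M\<close> and \<open>r\<close> the right
  operations \<open>M \<otimes> A \<rightarrow> M\<close>. The last three assumptions are the eleven axioms with \<open>x\<close>,
  respectively \<open>y\<close>, respectively \<open>z\<close> taken from \<open>M\<close>.\<close>

locale trias_representation =
  A: triassociative_algebra sA p + M: vector_space sM
  for sA :: "'k::field \<Rightarrow> 'a::ab_group_add \<Rightarrow> 'a"
    and p :: "trias_op \<Rightarrow> 'a \<Rightarrow> 'a \<Rightarrow> 'a"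
    and sM :: "'k \<Rightarrow> 'm::ab_group_add \<Rightarrow> 'm" +
  fixes l :: "trias_op \<Rightarrow> 'a \<Rightarrow> 'm \<Rightarrow> 'm"
    and r :: "trias_op \<Rightarrow> 'm \<Rightarrow> 'a \<Rightarrow> 'm"
  assumes left_bilinear: "\<And>c. bilinear_map sA sM sM (l c)"
    and right_bilinear: "\<And>c. bilinear_map sM sA sM (r c)"
    and axioms_left: "trias_axioms r r p r"
    and axioms_middle: "trias_axioms l r r l"
    and axioms_right: "trias_axioms p l l l"


section \<open>Planar trees\<close>

text \<open>\<open>Node [\<psi>\<^sub>0, \<dots>, \<psi>\<^sub>k]\<close> is the grafting \<open>\<psi>\<^sub>0 \<or> \<dots> \<or> \<psi>\<^sub>k\<close>; only the trees
  satisfying \<open>proper\<close> (every internal vertex has at least two incoming edges) are meant.\<close>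

datatype ptree = Leaf | Node "ptree list"

primrec leaves :: "ptree \<Rightarrow> nat" where
  "leaves Leaf = 1"
| "leaves (Node ts) = sum_list (map leaves ts)"

fun proper :: "ptree \<Rightarrow> bool" where
  "proper Leaf \<longleftrightarrow> True"
| "proper (Node ts) \<longleftrightarrow> length ts \<ge> 2 \<and> (\<forall>t\<in>set ts. proper t)"

definition degree :: "ptree \<Rightarrow> nat" where
  "degree t = leaves t - 1"

definition trees :: "nat \<Rightarrow> ptree set" where
  "trees n = {t. proper t \<and> leaves t = n + 1}"

text \<open>A vertex left with a single incoming edge is suppressed.\<close>

fun node_or_suppress :: "ptree list \<Rightarrow> ptree" where
  "node_or_suppress [t] = t"
| "node_or_suppress ts = Node ts"

text \<open>\<open>del_leaf i t\<close> is \<open>d\<^sub>i t\<close>. In \<open>del_forest\<close> and \<open>orient_forest\<close> below the leaves of a list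
  of trees are numbered consecutively from left to right, starting with \<open>0\<close>. The value
  at \<open>Leaf\<close> is a dummy, as \<open>d\<^sub>i\<close> is only defined on trees of positive degree.\<close>

fun del_leaf :: "nat \<Rightarrow> ptree \<Rightarrow> ptree"
  and del_forest :: "nat \<Rightarrow> ptree list \<Rightarrow> ptree list"
where
  "del_leaf i Leaf = Leaf"
| "del_leaf i (Node ts) = node_or_suppress (del_forest i ts)"
| "del_forest i [] = []"
| "del_forest i (t # ts) =
     (if i < leaves t
      then (case t of Leaf \<Rightarrow> ts | Node us \<Rightarrow> del_leaf i t # ts)
      else t # del_forest (i - leaves t) ts)"

datatype orientation = Left_oriented | Right_oriented | Middle

text \<open>The first argument of \<open>orient_forest\<close> tells whether the head of the list is the leftmost
  incoming edge of its vertex; it is the rightmost one iff the tail of the list is empty. The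
  values at \<open>Leaf\<close> and at the empty list are dummies.\<close>

fun orient :: "nat \<Rightarrow> ptree \<Rightarrow> orientation"
  and orient_forest :: "bool \<Rightarrow> nat \<Rightarrow> ptree list \<Rightarrow> orientation"
where
  "orient i Leaf = Middle"
| "orient i (Node ts) = orient_forest True i ts"
| "orient_forest leftmost i [] = Middle"
| "orient_forest leftmost i (t # ts) =
     (if i < leaves t
      then (case t of
              Leaf \<Rightarrow> (if leftmost then Left_oriented
                       else if ts = [] then Right_oriented else Middle)
            | Node us \<Rightarrow> orient i t)
      else orient_forest False (i - leaves t) ts)"

text \<open>\<open>circ i \<psi>\<close> is \<open>\<circ>\<^sub>i\<^sup>\<psi>\<close> for \<open>0 \<le> i \<le> |\<psi>|\<close> and \<open>|\<psi>| \<ge> 1\<close>; for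
  \<open>\<psi> = \<psi>\<^sub>0 \<or> \<dots> \<or> \<psi>\<^sub>k\<close> the condition \<open>k = 1\<close> reads \<open>length ts = 2\<close>.\<close>

primrec branches :: "ptree \<Rightarrow> ptree list" where
  "branches Leaf = []"
| "branches (Node ts) = ts"

definition circ :: "nat \<Rightarrow> ptree \<Rightarrow> trias_op" where
  "circ i \<psi> = (let ts = branches \<psi> in
     if i = 0 then
       (if degree (hd ts) > 0 then Vdash
        else if length ts = 2 then Dashv else Bot)
     else if i = degree \<psi> then
       (if degree (last ts) > 0 then Dashv
        else if length ts = 2 then Vdash else Bot)
     else
       (case orient i \<psi> of
          Left_oriented \<Rightarrow> Dashv | Right_oriented \<Rightarrow> Vdash | Middle \<Rightarrow> Bot))"


section \<open>Cochains\<close>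

definition multilinear ::
  "('k::field \<Rightarrow> 'a::ab_group_add \<Rightarrow> 'a) \<Rightarrow> ('k \<Rightarrow> 'm::ab_group_add \<Rightarrow> 'm) \<Rightarrow> nat \<Rightarrow>
   ('a list \<Rightarrow> 'm) \<Rightarrow> bool"
where
  "multilinear sA sM n g \<longleftrightarrow>
     (\<forall>as i. length as = n \<longrightarrow> i < n \<longrightarrow> Vector_Spaces.linear sA sM (\<lambda>x. g (as[i := x])))"

text \<open>A linear map \<open>K[T\<^sub>n] \<otimes> A\<^sup>\<otimes>\<^sup>n \<rightarrow> M\<close> is given by its values
  \<open>f(\<psi>; a\<^sub>1, \<dots>, a\<^sub>n)\<close> on the tensors \<open>\<psi> \<otimes> a\<^sub>1 \<otimes> \<dots> \<otimes> a\<^sub>n\<close>, which may be any family of maps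
  \<open>A\<^sup>n \<rightarrow> M\<close> indexed by \<open>\<psi> \<in> T\<^sub>n\<close> that are multilinear in \<open>(a\<^sub>1, \<dots>, a\<^sub>n)\<close>. Outside
  \<open>T\<^sub>n \<times> A\<^sup>n\<close> a cochain is set to \<open>0\<close>, so that equality of cochains is equality of functions.\<close>

type_synonym ('a, 'm) cochain = "ptree \<Rightarrow> 'a list \<Rightarrow> 'm"

definition cochains ::
  "('k::field \<Rightarrow> 'a::ab_group_add \<Rightarrow> 'a) \<Rightarrow> ('k \<Rightarrow> 'm::ab_group_add \<Rightarrow> 'm) \<Rightarrow> nat \<Rightarrow>
   ('a, 'm) cochain set"
where
  "cochains sA sM n =
     {f. (\<forall>\<psi>\<in>trees n. multilinear sA sM n (f \<psi>)) \<and>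
         (\<forall>\<psi> as. \<psi> \<notin> trees n \<or> length as \<noteq> n \<longrightarrow> f \<psi> as = 0)}"

definition scale_cochain ::
  "('k \<Rightarrow> 'm \<Rightarrow> 'm) \<Rightarrow> 'k \<Rightarrow> ('a, 'm) cochain \<Rightarrow> ('a, 'm) cochain"
where
  "scale_cochain sM c f = (\<lambda>\<psi> as. sM c (f \<psi> as))"

text \<open>\<open>coface p l r n i\<close> is \<open>\<delta>\<^sup>n\<^sub>i\<close> for \<open>i \<le> n + 1\<close>. The list \<open>as\<close> is
  \<open>[a\<^sub>1, \<dots>, a\<^bsub>n+1\<^esub>]\<close>, so \<open>a\<^sub>i = as ! (i - 1)\<close>.\<close>

definition coface ::
  "(trias_op \<Rightarrow> 'a \<Rightarrow> 'a \<Rightarrow> 'a) \<Rightarrow> (trias_op \<Rightarrow> 'a \<Rightarrow> 'm \<Rightarrow> 'm) \<Rightarrow>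
   (trias_op \<Rightarrow> 'm \<Rightarrow> 'a \<Rightarrow> 'm::ab_group_add) \<Rightarrow> nat \<Rightarrow> nat \<Rightarrow>
   ('a, 'm) cochain \<Rightarrow> ('a, 'm) cochain"
where
  "coface p l r n i f = (\<lambda>\<psi> as.
     if \<psi> \<in> trees (n + 1) \<and> length as = n + 1 then
       (if i = 0 then
          l (circ 0 \<psi>) (hd as) (f (del_leaf 0 \<psi>) (tl as))
        else if i \<le> n then
          f (del_leaf i \<psi>)
            (take (i - 1) as @ [p (circ i \<psi>) (as ! (i - 1)) (as ! i)] @ drop (i + 1) as)
        else
          r (circ (n + 1) \<psi>) (f (del_leaf (n + 1) \<psi>) (butlast as)) (last as))
     else 0)"

definition coboundary ::
  "(trias_op \<Rightarrow> 'a \<Rightarrow> 'a \<Rightarrow> 'a) \<Rightarrow> ('k::field \<Rightarrow> 'm \<Rightarrow> 'm) \<Rightarrow> (trias_op \<Rightarrow> 'a \<Rightarrow> 'm \<Rightarrow> 'm) \<Rightarrow>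
   (trias_op \<Rightarrow> 'm \<Rightarrow> 'a \<Rightarrow> 'm::ab_group_add) \<Rightarrow> nat \<Rightarrow>
   ('a, 'm) cochain \<Rightarrow> ('a, 'm) cochain"
where
  "coboundary p sM l r n f =
     (\<Sum>i=0..n+1. scale_cochain sM ((-1) ^ i) (coface p l r n i f))"


section \<open>Cochain complexes\<close>

definition linear_between ::
  "('k::field \<Rightarrow> 'v::ab_group_add \<Rightarrow> 'v) \<Rightarrow> 'v set \<Rightarrow> 'v set \<Rightarrow> ('v \<Rightarrow> 'v) \<Rightarrow> bool"
where
  "linear_between s U V d \<longleftrightarrow>
     (\<forall>x\<in>U. d x \<in> V) \<and>
     (\<forall>x\<in>U. \<forall>y\<in>U. d (x + y) = d x + d y) \<and>
     (\<forall>c. \<forall>x\<in>U. d (s c x) = s c (d x))"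

text \<open>A cochain complex in degrees \<open>n \<ge> 0\<close> whose terms are subspaces of one ambient vector
  space with scalar multiplication \<open>s\<close>.\<close>

definition cochain_complex ::
  "('k::field \<Rightarrow> 'v::ab_group_add \<Rightarrow> 'v) \<Rightarrow> (nat \<Rightarrow> 'v set) \<Rightarrow> (nat \<Rightarrow> 'v \<Rightarrow> 'v) \<Rightarrow> bool"
where
  "cochain_complex s C d \<longleftrightarrow>
     vector_space s \<and>
     (\<forall>n. module.subspace s (C n)) \<and>
     (\<forall>n. linear_between s (C n) (C (n + 1)) (d n)) \<and>
     (\<forall>n. \<forall>x\<in>C n. d (n + 1) (d n x) = 0)"

end

theory Submission
  imports Defs
begin

text \<open>Label the gap between leaves \<open>i - 1\<close> and \<open>i\<close> of a tree with the height \<open>h\<^sub>i\<close> of the vertex at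
  which these leaves meet. Deleting a leaf replaces the two adjacent heights by their maximum,
  and \<open>\<circ>\<^sub>i\<close> is \<open>\<stileturn>\<close>, \<open>\<turnstile>\<close> or \<open>\<bottom>\<close> according as \<open>h\<^sub>i\<close> is larger than, smaller than or equal to
  \<open>h\<^bsub>i+1\<^esub>\<close> (for \<open>\<circ>\<^sub>0\<close> and the last operation: the extreme height is compared with the maximum of
  the others). The eleven axioms say exactly that the product
  \<open>(h, a) (k, b) = (max h k, a \<circ>\<^bsub>h,k\<^esub> b)\<close> of pairs, with the operation determined by comparing
  \<open>h\<close> and \<open>k\<close>, is associative. Hence the maps \<open>\<delta>\<^sub>i\<close> are the Hochschild coface maps of this
  semigroup of weighted elements, and the cosimplicial identities follow from associativity.\<close>

section \<open>Trees from heights\<close>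

text \<open>Separators at the ends or next to each other leave empty pieces; these become the
  \<open>Leaf\<close> branches of a vertex of height \<open>d\<close>.\<close>

primrec split_at :: "'b \<Rightarrow> 'b list \<Rightarrow> 'b list list" where
  "split_at d [] = [[]]"
| "split_at d (x # xs) =
     (if x = d then [] # split_at d xs
      else (x # hd (split_at d xs)) # tl (split_at d xs))"

text \<open>\<open>tree_of d hs\<close> is the tree with list of heights \<open>hs\<close>, all smaller than \<open>d\<close>. Levels \<open>d\<close> that do
  not occur in \<open>hs\<close> give a single branch, which is suppressed, so only the relative order of
  the heights matters.\<close>

primrec tree_of :: "nat \<Rightarrow> nat list \<Rightarrow> ptree" where
  "tree_of 0 hs = Leaf"
| "tree_of (Suc d) hs = node_or_suppress (map (tree_of d) (split_at d hs))"

section \<open>Pieces of a list of heights\<close>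

lemma split_at_nonempty [simp]: "split_at d xs \<noteq> []"
  by (cases xs) auto

lemma split_at_notin: "d \<notin> set xs \<Longrightarrow> split_at d xs = [xs]"
  by (induction xs) auto

lemma split_at_append: "d \<notin> set xs \<Longrightarrow> split_at d (xs @ d # ys) = xs # split_at d ys"
  by (induction xs) auto

lemma length_split_at: "length (split_at d xs) = count_list xs d + 1"
  by (induction xs) auto

lemma hd_split_at_Nil: "xs \<noteq> [] \<Longrightarrow> hd (split_at d xs) = [] \<longleftrightarrow> hd xs = d"
  by (cases xs) auto

text \<open>Induction branch by branch instead of entry by entry: in the case \<open>append\<close>,
  \<open>xs\<close> holds the heights of the first branch of a vertex of height \<open>d\<close>,
  and \<open>ys\<close> those of everything behind the first separator.\<close>

lemma split_at_induct [case_names notin append]: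
  assumes "\<And>xs. d \<notin> set xs \<Longrightarrow> P xs"
    and "\<And>xs ys. d \<notin> set xs \<Longrightarrow> P ys \<Longrightarrow> P (xs @ d # ys)"
  shows "P xs"
proof (induction "length xs" arbitrary: xs rule: less_induct)
  case less
  show ?case
  proof (cases "d \<in> set xs")
    case True
    then obtain us vs where "xs = us @ d # vs" "d \<notin> set us"
      by (metis split_list_first)
    then show ?thesis
      using less assms(2) by simp
  qed (use assms(1) in auto)
qed

lemma last_split_at_Nil: "xs \<noteq> [] \<Longrightarrow> last (split_at d xs) = [] \<longleftrightarrow> last xs = d"
proof (induction xs rule: split_at_induct[of d])
  case (notin xs)
  then show ?case
    using last_in_set[of xs] by (auto simp: split_at_notin)
next
  case (append xs ys)
  then show ?case
    by (cases "ys = []") (auto simp: split_at_append)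
qed

lemma split_at_subset:
  assumes "ys \<in> set (split_at d xs)" "set xs \<subseteq> {..<Suc d}"
  shows "set ys \<subseteq> {..<d}"
  using assms
proof (induction xs arbitrary: ys rule: split_at_induct[of d])
  case (notin xs)
  then show ?case
    by (auto simp: split_at_notin less_Suc_eq)
next
  case (append xs zs)
  then show ?case
    by (auto simp: split_at_append less_Suc_eq)
qed

lemma sum_list_split_at:
  "sum_list (map (\<lambda>ys. length ys + 1) (split_at d xs)) = length xs + 1"
proof (induction xs rule: split_at_induct[of d])
qed (auto simp: split_at_notin split_at_append)

section \<open>Leaf count and properness of trees built from heights\<close>

lemma leaves_node_or_suppress:
  "ts \<noteq> [] \<Longrightarrow> leaves (node_or_suppress ts) = sum_list (map leaves ts)"
  by (cases ts rule: node_or_suppress.cases) auto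

lemma proper_node_or_suppress:
  "ts \<noteq> [] \<Longrightarrow> \<forall>t\<in>set ts. proper t \<Longrightarrow> proper (node_or_suppress ts)"
  by (cases ts rule: node_or_suppress.cases) auto

lemma leaves_tree_of [simp]: "set hs \<subseteq> {..<d} \<Longrightarrow> leaves (tree_of d hs) = length hs + 1"
proof (induction d arbitrary: hs)
  case (Suc d)
  have "map leaves (map (tree_of d) (split_at d hs)) = map (\<lambda>ys. length ys + 1) (split_at d hs)"
    using Suc.IH[OF split_at_subset[OF _ Suc.prems]] by simp
  then show ?case
    using sum_list_split_at[of d hs] by (simp add: leaves_node_or_suppress del: map_map)
qed auto

lemma proper_tree_of: "proper (tree_of d hs)"
  by (induction d arbitrary: hs) (auto intro!: proper_node_or_suppress)

lemma leaves_pos: "proper t \<Longrightarrow> leaves t > 0"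
proof (induction t)
  case (Node ts)
  then show ?case
    by (cases ts) auto
qed auto

lemma proper_leaves_eq_1: "proper t \<Longrightarrow> leaves t = 1 \<longleftrightarrow> t = Leaf"
proof (cases t)
  case (Node ts)
  moreover assume "proper t"
  ultimately show ?thesis
    using leaves_pos by (auto simp: Suc_le_length_iff numeral_2_eq_2) (metis add_gr_0 nat_neq_iff add_is_1)
qed auto

lemma tree_of_eq_Leaf [simp]:
  "set hs \<subseteq> {..<d} \<Longrightarrow> tree_of d hs = Leaf \<longleftrightarrow> hs = []"
  using proper_leaves_eq_1[OF proper_tree_of] by (metis leaves_tree_of add_cancel_left_left length_0_conv)

lemma tree_of_mono: "set hs \<subseteq> {..<d} \<Longrightarrow> d \<le> e \<Longrightarrow> tree_of e hs = tree_of d hs"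
proof (induction e)
  case (Suc e)
  show ?case
  proof (cases "d = Suc e")
    case False
    then have "e \<notin> set hs"
      using Suc.prems by fastforce
    with False Suc show ?thesis
      by (simp add: split_at_notin)
  qed simp
qed auto

section \<open>Heights for a given proper tree\<close>

lemma ex_split_at_map:
  fixes d :: nat
  assumes "\<And>t. t \<in> set ts \<Longrightarrow> \<exists>hs. set hs \<subseteq> {0<..<d} \<and> f hs = t" "ts \<noteq> []" "0 < d"
  shows "\<exists>hs. set hs \<subseteq> {0<..d} \<and> map f (split_at d hs) = ts"
  using assms(1,2)
proof (induction ts)
  case (Cons t ts)
  obtain hs where hs: "set hs \<subseteq> {0<..<d}" "f hs = t"
    using Cons.prems(1)[of t] by auto
  then have d: "d \<notin> set hs"
    by fastforce
  show ?case
  proof (cases "ts = []")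
    case True
    then have "set hs \<subseteq> {0<..d} \<and> map f (split_at d hs) = t # ts"
      using hs d by (simp add: split_at_notin subset_iff less_imp_le)
    then show ?thesis ..
  next
    case False
    then obtain gs where "set gs \<subseteq> {0<..d}" "map f (split_at d gs) = ts"
      using Cons by auto
    \<comment> \<open>The vertex joining the branches gets height \<open>d\<close>, written between
      the heights of consecutive branches.\<close>
    then have "set (hs @ d # gs) \<subseteq> {0<..d} \<and> map f (split_at d (hs @ d # gs)) = t # ts"
      using hs d \<open>0 < d\<close> by (simp add: split_at_append subset_iff less_imp_le)
    then show ?thesis ..
  qed
qed auto

text \<open>Heights are chosen positive because \<open>circ_tree_of\<close> compares them with
  \<open>max_height [] = 0\<close>.\<close>

lemma ex_tree_of:
  "proper t \<Longrightarrow> \<exists>d hs. set hs \<subseteq> {0<..<d} \<and> tree_of d hs = t"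
proof (induction t)
  case Leaf
  show ?case
    by (rule exI[of _ 0], rule exI[of _ "[]"]) simp
next
  case (Node ts)
  have "ts \<noteq> []"
    using Node.prems by auto
  have "\<forall>t\<in>set ts. \<exists>d hs. set hs \<subseteq> {0<..<d} \<and> tree_of d hs = t"
    using Node.IH Node.prems by simp
  then obtain D H where DH: "\<forall>t\<in>set ts. set (H t) \<subseteq> {0<..<D t} \<and> tree_of (D t) (H t) = t"
    by metis
  then have H: "set (H t) \<subseteq> {0<..<D t}" if "t \<in> set ts" for t
    using that by simp
  \<comment> \<open>A common level for all branches: by \<open>tree_of_mono\<close> each branch
    keeps its heights there. \<open>Suc\<close> makes \<open>d\<close> positive, so that
    \<open>d\<close> itself can be the height of the root vertex.\<close>
  define d where "d = Suc (Max (D ` set ts))"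
  then have "0 < d"
    by simp
  have D: "D t \<le> d" if "t \<in> set ts" for t
    using that by (simp add: d_def le_SucI)
  have ex: "\<exists>hs. set hs \<subseteq> {0<..<d} \<and> tree_of d hs = t" if t: "t \<in> set ts" for t
  proof (rule exI[of _ "H t"], rule conjI)
    show "set (H t) \<subseteq> {0<..<d}"
      by (rule order_trans[OF H[OF t]]) (use D[OF t] in auto)
    have "set (H t) \<subseteq> {..<D t}"
      using H[OF t] by (rule order_trans) auto
    then have "tree_of d (H t) = tree_of (D t) (H t)"
      using D[OF t] by (rule tree_of_mono)
    also have "\<dots> = t"
      using bspec[OF DH t] by (rule conjunct2)
    finally show "tree_of d (H t) = t" .
  qed
  obtain hs where hs: "set hs \<subseteq> {0<..d}" "map (tree_of d) (split_at d hs) = ts"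
    using ex_split_at_map[of ts d "tree_of d", OF ex \<open>ts \<noteq> []\<close> \<open>0 < d\<close>] by blast
  have "node_or_suppress ts = Node ts"
    using Node.prems by (cases ts rule: node_or_suppress.cases) auto
  with hs have "set hs \<subseteq> {0<..<Suc d} \<and> tree_of (Suc d) hs = Node ts"
    by (simp add: subset_iff less_Suc_eq_le)
  then show ?case
    by - (rule exI[of _ "Suc d"], rule exI[of _ hs])
qed

text \<open>An occurrence of \<open>d\<close> produces at least two pieces, so the vertex is not
  suppressed.\<close>

lemma tree_of_Suc_eq_Node:
  assumes "d \<in> set hs"
  shows "tree_of (Suc d) hs = Node (map (tree_of d) (split_at d hs))"
proof -
  have "length (map (tree_of d) (split_at d hs)) \<ge> 2"
    using assms count_list_0_iff[of hs d] by (simp add: length_split_at)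
  then show ?thesis
    unfolding tree_of.simps
    by (cases "map (tree_of d) (split_at d hs)" rule: node_or_suppress.cases) auto
qed

lemma tree_of_Nil [simp]: "tree_of d [] = Leaf"
  by (induction d) auto

section \<open>Deletion of leaves and orientations in terms of heights\<close>

text \<open>Leaf \<open>i\<close> lies between the entries \<open>i - 1\<close> and
  \<open>i\<close>. An outermost leaf has only one adjacent entry, which disappears with it. The
  operation \<open>f\<close> is \<open>max\<close> on heights and \<open>weighted_op p\<close> on
  weighted elements.\<close>

definition merge :: "('b \<Rightarrow> 'b \<Rightarrow> 'b) \<Rightarrow> nat \<Rightarrow> 'b list \<Rightarrow> 'b list" where
  "merge f i xs =
     (if i = 0 then tl xs
      else if i < length xs then take (i - 1) xs @ [f (xs ! (i - 1)) (xs ! i)] @ drop (i + 1) xs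
      else butlast xs)"

text \<open>At \<open>i = length xs\<close> the last entry of \<open>xs\<close> meets the separator
  \<open>d\<close> and is absorbed by it, which amounts to dropping it from
  \<open>xs\<close>.\<close>

lemma merge_append_left:
  fixes d :: nat
  assumes "set xs \<subseteq> {..<d}" "xs \<noteq> []" "i \<le> length xs"
  shows "merge max i (xs @ d # ys) = merge max i xs @ d # ys"
proof -
  consider "i = 0" | "0 < i" "i < length xs" | "i = length xs"
    using assms by linarith
  then show ?thesis
  proof cases
    case 3
    have "xs ! (length xs - Suc 0) < d"
      using assms by (metis One_nat_def diff_less length_greater_0_conv lessThan_iff less_one nth_mem subsetD)
    then have "max (xs ! (length xs - Suc 0)) d = d"
      by simp
    with 3 show ?thesis
      using assms by (auto simp: merge_def nth_append butlast_conv_take)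
  qed (use assms in \<open>auto simp: merge_def nth_append\<close>)
qed

text \<open>At \<open>i = 0\<close> the separator \<open>d\<close> absorbs the first entry of
  \<open>ys\<close>, since no entry exceeds \<open>d\<close>.\<close>

lemma merge_append_right:
  fixes d :: nat
  assumes "set ys \<subseteq> {..d}" "ys \<noteq> []" "i \<le> length ys"
  shows "merge max (Suc (length xs + i)) (xs @ d # ys) = xs @ d # merge max i ys"
proof -
  consider "i = 0" | "0 < i" "i < length ys" | "0 < i" "i = length ys"
    using assms by linarith
  then show ?thesis
  proof cases
    case 1
    then show ?thesis
      using assms by (cases ys) (auto simp: merge_def nth_append max_def)
  next
    case 2
    then obtain j where "i = Suc j"
      by (cases i) auto
    then show ?thesis
      using assms 2 by (auto simp: merge_def nth_append drop_Cons')
  next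
    case 3
    then show ?thesis
      using assms by (auto simp: merge_def butlast_append)
  qed
qed

lemma merge_append_end: "merge f (Suc (length xs)) (xs @ [d]) = xs"
  by (simp add: merge_def)

lemma set_merge:
  assumes "\<And>x y. x \<in> S \<Longrightarrow> y \<in> S \<Longrightarrow> f x y \<in> S" "set xs \<subseteq> S"
  shows "set (merge f i xs) \<subseteq> S"
proof -
  have "set (tl xs) \<subseteq> S"
    using assms(2) by (cases xs) auto
  moreover have "f (xs ! (i - 1)) (xs ! i) \<in> S" if "i < length xs"
    using that assms by (intro assms(1)) (auto simp: subset_iff)
  ultimately show ?thesis
    using assms(2) set_take_subset[of "i - 1" xs] set_drop_subset[of "i + 1" xs]
    by (auto simp: merge_def dest!: in_set_butlastD)
qed

lemma length_merge [simp]: "i \<le> length xs \<Longrightarrow> length (merge f i xs) = length xs - 1"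
  by (auto simp: merge_def)

section \<open>Deleting a leaf merges its adjacent heights\<close>

lemma del_leaf_node_or_suppress:
  assumes "ts \<noteq> []" "ts \<noteq> [Leaf]" "i < sum_list (map leaves ts)"
  shows "del_leaf i (node_or_suppress ts) = node_or_suppress (del_forest i ts)"
proof (cases "length ts = 1")
  case True
  \<comment> \<open>The forest \<open>[Leaf]\<close> has to be excluded: \<open>del_leaf\<close> has
    the dummy value \<open>Leaf\<close> there, whereas deleting from the forest would leave
    \<open>Node []\<close>.\<close>
  then obtain us where "ts = [Node us]"
    using assms by (cases ts) (auto elim: ptree.exhaust, metis ptree.exhaust)
  then show ?thesis
    using assms by simp
next
  case False
  then show ?thesis
    using assms by (cases ts rule: node_or_suppress.cases) auto
qed

lemma del_forest_Cons:
  "del_forest i (t # ts) =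
     (if i < leaves t then (if t = Leaf then ts else del_leaf i t # ts)
      else t # del_forest (i - leaves t) ts)"
  by (cases t) auto

declare del_forest.simps(2) [simp del]

text \<open>Induction on the level. If the deleted leaf lies in a branch with several leaves, the
  merge takes place among the heights of that branch; if the leaf is a branch by itself, one
  separator is lost.\<close>

lemma del_leaf_tree_of:
  assumes "set hs \<subseteq> {..<d}" "hs \<noteq> []" "i \<le> length hs"
  shows "del_leaf i (tree_of d hs) = tree_of d (merge max i hs)"
  using assms
proof (induction d arbitrary: hs i)
  case (Suc d)
  have forest: "del_forest i (map (tree_of d) (split_at d hs)) =
      map (tree_of d) (split_at d (merge max i hs))"
    if "set hs \<subseteq> {..d}" "hs \<noteq> []" "i \<le> length hs" for hs i
    using that
  proof (induction hs arbitrary: i rule: split_at_induct[of d])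
    case (notin xs)
    then have xs: "set xs \<subseteq> {..<d}"
      by (auto simp: subset_iff le_less)
    then have "set (merge max i xs) \<subseteq> {..<d}"
      by (intro set_merge) auto
    then have "d \<notin> set (merge max i xs)"
      by auto
    then show ?case
      using notin xs Suc.IH[OF xs] by (simp add: split_at_notin del_forest_Cons)
  next
    case (append xs ys)
    then have xs: "set xs \<subseteq> {..<d}" and ys: "set ys \<subseteq> {..d}"
      by (auto simp: subset_iff le_less)
    show ?case
    proof (cases "i \<le> length xs")
      case True
      show ?thesis
      proof (cases "xs = []")
        \<comment> \<open>The first branch is a single leaf and \<open>i = 0\<close>, so the
          separator behind it is dropped.\<close>
        case True
        with \<open>i \<le> length xs\<close> xs show ?thesis
          by (simp add: del_forest_Cons merge_def)
      next
        case False
        have "set (merge max i xs) \<subseteq> {..<d}"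
          using xs by (intro set_merge) auto
        then have "d \<notin> set (merge max i xs)"
          by auto
        then show ?thesis
          using False True xs Suc.IH[OF xs] append(1)
          by (simp add: split_at_append del_forest_Cons merge_append_left)
      qed
    next
      case False
      \<comment> \<open>The first branch has \<open>length xs + 1\<close> leaves, so the leaf has
        number \<open>j\<close> among the remaining branches.\<close>
      then obtain j where i: "i = Suc (length xs + j)"
        by (metis less_iff_Suc_add not_le)
      show ?thesis
      proof (cases "ys = []")
        \<comment> \<open>Here \<open>j = 0\<close>: the last branch is a single leaf, and it
          vanishes together with the separator before it.\<close>
        case True
        then show ?thesis
          using append xs i
          by (simp add: split_at_append split_at_notin del_forest_Cons merge_append_end)
      next
        case False
        then show ?thesis
          using append(1,5) append(2)[of j] xs ys i
          by (simp add: split_at_append del_forest_Cons merge_append_right)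
      qed
    qed
  qed
  let ?ts = "map (tree_of d) (split_at d hs)"
  have hs: "set hs \<subseteq> {..d}"
    using Suc.prems by auto
  have "leaves (tree_of (Suc d) hs) = length hs + 1"
    using Suc.prems(1) by (rule leaves_tree_of)
  then have "sum_list (map leaves ?ts) = length hs + 1"
    by (simp add: leaves_node_or_suppress del: map_map)
  moreover from this have "?ts \<noteq> [Leaf]"
    using Suc.prems by auto
  ultimately have "del_leaf i (tree_of (Suc d) hs) = node_or_suppress (del_forest i ?ts)"
    unfolding tree_of.simps using Suc.prems by (intro del_leaf_node_or_suppress) auto
  then show ?case
    using forest[OF hs] Suc.prems by simp
qed auto

section \<open>Orientation of leaves by comparing heights\<close>

lemma orient_forest_Cons:
  "orient_forest b i (t # ts) =
     (if i < leaves t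
      then (if t = Leaf then (if b then Left_oriented else if ts = [] then Right_oriented else Middle)
            else orient i t)
      else orient_forest False (i - leaves t) ts)"
  by (cases t) auto

declare orient_forest.simps(2) [simp del]

text \<open>A leaf is attached to the vertex of the smaller adjacent height. If the left height is
  larger, the leaf is the leftmost edge of the vertex where it meets its right neighbour.\<close>

definition compare_heights :: "nat \<Rightarrow> nat \<Rightarrow> orientation" where
  "compare_heights x y =
     (if x > y then Left_oriented else if x < y then Right_oriented else Middle)"

text \<open>The leftmost and the rightmost leaf are oriented as if the list of heights were bordered
  by values larger than the height of the root.\<close>

lemma orient_tree_of:
  assumes "set hs \<subseteq> {..<d}" "hs \<noteq> []" "i \<le> length hs" "d \<le> x" "d \<le> y"
  shows "orient i (tree_of d hs) = compare_heights ((x # hs) ! i) ((hs @ [y]) ! i)"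
  using assms
proof (induction d arbitrary: hs i x y)
  case (Suc d)
  \<comment> \<open>The left border of a branch that is not leftmost is the separator
    \<open>d\<close> before it. For \<open>b\<close> true the empty list is excluded, since a lone
    leaf would be leftmost and rightmost at once.\<close>
  have forest: "orient_forest b i (map (tree_of d) (split_at d hs)) =
      compare_heights ((x # hs) ! i) ((hs @ [y]) ! i)"
    if "set hs \<subseteq> {..d}" "hs \<noteq> [] \<or> \<not> b" "i \<le> length hs" "d < y"
      "if b then d < x else x = d" for hs i b x
    using that
  proof (induction hs arbitrary: i b x rule: split_at_induct[of d])
    case (notin xs)
    then have xs: "set xs \<subseteq> {..<d}"
      by (auto simp: subset_iff le_less)
    show ?case
    proof (cases "xs = []")
      case True
      then show ?thesis
        using notin by (simp add: orient_forest_Cons compare_heights_def)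
    next
      case False
      then show ?thesis
        using notin xs Suc.IH[OF xs, of i x y]
        by (cases b) (simp_all add: split_at_notin orient_forest_Cons)
    qed
  next
    case (append xs ys)
    then have xs: "set xs \<subseteq> {..<d}" and ys: "set ys \<subseteq> {..d}"
      by (auto simp: subset_iff le_less)
    show ?case
    proof (cases "i \<le> length xs")
      case True
      \<comment> \<open>Within the first branch the separator \<open>d\<close> serves as right
        border, which the outer induction hypothesis allows.\<close>
      have "(x # xs @ d # ys) ! i = (x # xs) ! i" "((xs @ d # ys) @ [y]) ! i = (xs @ [d]) ! i"
        using True by (auto simp: nth_append nth_Cons split: nat.splits)
      then show ?thesis
        using append xs True Suc.IH[OF xs, of i x d]
        by (cases "xs = []"; cases b)
           (simp_all add: split_at_append orient_forest_Cons compare_heights_def)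
    next
      case False
      then obtain j where i: "i = Suc (length xs + j)"
        by (metis less_iff_Suc_add not_le)
      have "(x # xs @ d # ys) ! i = (d # ys) ! j" "((xs @ d # ys) @ [y]) ! i = (ys @ [y]) ! j"
        using i by (auto simp: nth_append)
      then show ?thesis
        using append(1,5,6) append(2)[of False j d] xs ys i
        by (simp add: split_at_append orient_forest_Cons)
    qed
  qed
  show ?case
  proof (cases "d \<in> set hs")
    case True
    then have "tree_of (Suc d) hs = Node (map (tree_of d) (split_at d hs))"
      by (rule tree_of_Suc_eq_Node)
    moreover have "set hs \<subseteq> {..d}"
      using Suc.prems by auto
    ultimately show ?thesis
      using forest[of hs True i x] Suc.prems by simp
  next
    case False
    then have "set hs \<subseteq> {..<d}"
      using Suc.prems by (auto simp: subset_iff less_Suc_eq)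
    then show ?thesis
      using Suc False by (simp add: split_at_notin)
  qed
qed auto


section \<open>The operations \<open>circ\<close> in terms of heights\<close>

definition max_height :: "nat list \<Rightarrow> nat" where
  "max_height hs = foldr max hs 0"

lemma max_height_simps [simp]:
  "max_height [] = 0"
  "max_height (x # xs) = max x (max_height xs)"
  "max_height (xs @ ys) = max (max_height xs) (max_height ys)"
  by (induction xs) (auto simp: max_height_def)

lemma max_height_ge: "x \<in> set xs \<Longrightarrow> x \<le> max_height xs"
  by (induction xs) auto

lemma max_height_in: "xs \<noteq> [] \<Longrightarrow> max_height xs \<in> set xs"
proof (induction xs)
  case (Cons x xs)
  then show ?case
    by (cases "xs = []") (auto simp: max_def)
qed auto

definition op_of :: "nat \<Rightarrow> nat \<Rightarrow> trias_op" where
  "op_of x y = (if x > y then Dashv else if x < y then Vdash else Bot)"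

text \<open>For positive heights the comparison at either end with the maximum of the other heights
  also covers the tree with two leaves, where that maximum is \<open>max_height [] = 0\<close>.\<close>

lemma circ_tree_of:
  assumes hs: "set hs \<subseteq> {0<..<d}" "hs \<noteq> []" and i: "i \<le> length hs"
  shows "circ i (tree_of d hs) =
    (if i = 0 then op_of (hd hs) (max_height (tl hs))
     else if i < length hs then op_of (hs ! (i - 1)) (hs ! i)
     else op_of (max_height (butlast hs)) (last hs))"
proof -
  \<comment> \<open>\<open>m\<close> is the height of the root vertex; going down to level
    \<open>Suc m\<close> removes the suppressed levels above it and exposes the branches.\<close>
  define m where "m = max_height hs"
  have hs': "set hs \<subseteq> {..<d}"
    using hs(1) by (rule order_trans) auto
  have m: "m \<in> set hs" "set hs \<subseteq> {..<Suc m}"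
    using max_height_in[OF hs(2)] max_height_ge by (auto simp: m_def less_Suc_eq_le)
  have "tree_of d hs = tree_of (Suc m) hs"
    using m hs' by (intro tree_of_mono) auto
  also have "\<dots> = Node (map (tree_of m) (split_at m hs))"
    using m(1) by (rule tree_of_Suc_eq_Node)
  finally have branches: "branches (tree_of d hs) = map (tree_of m) (split_at m hs)"
    by simp
  have deg: "degree (tree_of d hs) = length hs"
    using hs' by (simp add: degree_def)
  have deg_branch: "degree (tree_of m ys) > 0 \<longleftrightarrow> ys \<noteq> []" if "ys \<in> set (split_at m hs)" for ys
    using split_at_subset[OF that m(2)] by (simp add: degree_def)
  have len2: "length (split_at m hs) = 2 \<longleftrightarrow> count_list hs m = 1"
    by (simp add: length_split_at)
  consider "i = 0" | "0 < i" "i < length hs" | "i = length hs" "0 < i"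
    using i by linarith
  then show ?thesis
  proof cases
    case 1
    obtain x xs where x: "hs = x # xs"
      using hs(2) by (cases hs) auto
    \<comment> \<open>The first branch is a leaf exactly when the first height is a root height, and
      the root has two branches exactly when \<open>m\<close> occurs once.\<close>
    have "degree (hd (map (tree_of m) (split_at m hs))) > 0 \<longleftrightarrow> x \<noteq> m"
      using deg_branch[of "hd (split_at m hs)"] hd_split_at_Nil[OF hs(2), of m] x
      by (simp add: hd_map del: split_at.simps)
    then have "circ 0 (tree_of d hs) =
        (if x \<noteq> m then Vdash else if count_list hs m = 1 then Dashv else Bot)"
      unfolding circ_def branches Let_def by (simp add: len2 del: split_at.simps)
    also have "\<dots> = op_of x (max_height xs)"
    proof (cases "x > max_height xs")
      case True
      then have "m = x" "x \<notin> set xs"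
        using max_height_ge[of x xs] by (auto simp: m_def x)
      then show ?thesis
        using True by (simp add: op_of_def x)
    next
      case False
      \<comment> \<open>Positivity rules out \<open>xs = []\<close>, so a tie
        \<open>x = max_height xs\<close> really gives a second occurrence of
        \<open>m\<close>.\<close>
      moreover have "x > 0"
        using hs(1) x by auto
      ultimately have "max_height xs \<in> set xs"
        by (intro max_height_in) auto
      then have "count_list xs (max_height xs) \<noteq> 0"
        by (simp add: count_list_0_iff)
      with False show ?thesis
        by (auto simp: op_of_def x m_def max_def)
    qed
    finally show ?thesis
      using 1 x by simp
  next
    case 2
    have "orient i (tree_of d hs) = compare_heights (hs ! (i - 1)) (hs ! i)"
      using orient_tree_of[OF hs', of i d d] 2 i hs(2) by (simp add: nth_append nth_Cons')
    then show ?thesis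
      using 2 by (simp add: circ_def deg compare_heights_def op_of_def)
  next
    case 3
    obtain x xs where x: "hs = xs @ [x]"
      using hs(2) by (cases hs rule: rev_cases) auto
    have "degree (last (map (tree_of m) (split_at m hs))) > 0 \<longleftrightarrow> x \<noteq> m"
      using deg_branch[of "last (split_at m hs)"] last_split_at_Nil[OF hs(2), of m] x
      by (simp add: last_map)
    then have "circ i (tree_of d hs) =
        (if x \<noteq> m then Dashv else if count_list hs m = 1 then Vdash else Bot)"
      using 3 unfolding circ_def branches Let_def by (simp add: len2 deg)
    also have "\<dots> = op_of (max_height xs) x"
    proof (cases "x > max_height xs")
      case True
      then have "m = x" "x \<notin> set xs"
        using max_height_ge[of x xs] by (auto simp: m_def x)
      then show ?thesis
        using True by (simp add: op_of_def x)
    next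
      case False
      moreover have "x > 0"
        using hs(1) x by auto
      ultimately have "max_height xs \<in> set xs"
        by (intro max_height_in) auto
      then have "count_list xs (max_height xs) \<noteq> 0"
        by (simp add: count_list_0_iff)
      with False show ?thesis
        by (auto simp: op_of_def x m_def max_def)
    qed
    finally show ?thesis
      using 3 x by simp
  qed
qed

section \<open>Hochschild faces\<close>

text \<open>The Hochschild coface maps for a semigroup acting on a set from both sides, without any
  linear structure.\<close>

definition face ::
  "('b \<Rightarrow> 'b \<Rightarrow> 'b) \<Rightarrow> ('b \<Rightarrow> 'c \<Rightarrow> 'c) \<Rightarrow> ('c \<Rightarrow> 'b \<Rightarrow> 'c) \<Rightarrow> nat \<Rightarrow> ('b list \<Rightarrow> 'c) \<Rightarrow> 'b list \<Rightarrow> 'c"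
where
  "face mul L R i G xs =
     (if i = 0 then L (hd xs) (G (merge mul i xs))
      else if i < length xs then G (merge mul i xs)
      else R (G (merge mul i xs)) (last xs))"

lemma merge_simps:
  "merge f 0 xs = tl xs"
  "merge f (Suc 0) [x] = []"
  "merge f (Suc 0) (x # y # zs) = f x y # zs"
  "zs \<noteq> [] \<Longrightarrow> merge f (Suc (Suc i)) (x # zs) = x # merge f (Suc i) zs"
  by (auto simp: merge_def)

text \<open>Associativity enters when \<open>j = i + 1\<close>, where both sides multiply the same
  three neighbours; merges further apart do not interact.\<close>

lemma merge_merge:
  assumes assoc: "\<And>x y z. f (f x y) z = f x (f y z)"
  shows "i < j \<Longrightarrow> j \<le> length xs \<Longrightarrow> merge f i (merge f j xs) = merge f (j - 1) (merge f i xs)"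
proof (induction xs arbitrary: i j)
  case (Cons x xs)
  obtain k where j: "j = Suc k"
    using Cons.prems by (cases j) auto
  show ?case
  proof (cases k)
    case 0
    then show ?thesis
      using j Cons.prems by (cases xs) (auto simp: merge_simps)
  next
    case (Suc k')
    then have xs: "xs \<noteq> []"
      using j Cons.prems by auto
    consider "i = 0" | "i = Suc 0" | i' where "i = Suc (Suc i')"
      by (metis not0_implies_Suc)
    then show ?thesis
    proof cases
      case 1
      then show ?thesis
        using j Suc xs by (simp add: merge_simps)
    next
      case 2
      then obtain y ys where ys: "xs = y # ys"
        using xs by (cases xs) auto
      show ?thesis
      proof (cases "k' = 0")
        case True
        then show ?thesis
          using 2 j Suc ys assoc by (cases ys) (auto simp: merge_simps)
      next
        case False
        then obtain k'' where "k' = Suc k''" "ys \<noteq> []"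
          using j Suc ys Cons.prems by (cases k'; cases ys) auto
        then show ?thesis
          using 2 j Suc ys by (cases "length ys = 1") (auto simp: merge_simps)
      qed
    next
      case 3
      have "1 < length xs"
        using Cons.prems 3 by simp
      then have "length (merge f k xs) \<noteq> 0" "length (merge f (Suc i') xs) \<noteq> 0"
        using Cons.prems 3 j by simp_all
      then have "merge f k xs \<noteq> []" "merge f (Suc i') xs \<noteq> []"
        by auto
      then show ?thesis
        using Cons.IH[of "Suc i'" k] Cons.prems 3 j Suc xs by (cases k') (simp_all add: merge_simps)
    qed
  qed
qed auto

lemma hd_merge:
  "1 < i \<Longrightarrow> i \<le> length xs \<Longrightarrow> hd (merge f i xs) = hd xs"
  "1 < length xs \<Longrightarrow> hd (merge f 1 xs) = f (hd xs) (hd (tl xs))"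
proof -
  assume "1 < i" "i \<le> length xs"
  then obtain k y ys where "i = Suc (Suc k)" "xs = y # ys" "ys \<noteq> []"
    by (cases i; cases "i - 1"; cases xs; cases "tl xs") auto
  then show "hd (merge f i xs) = hd xs"
    by (simp add: merge_simps)
next
  assume "1 < length xs"
  then obtain y z ys where "xs = y # z # ys"
    by (cases xs; cases "tl xs") auto
  then show "hd (merge f 1 xs) = f (hd xs) (hd (tl xs))"
    by (simp add: merge_simps)
qed

lemma last_merge:
  "i < length xs - 1 \<Longrightarrow> last (merge f i xs) = last xs"
  "1 < length xs \<Longrightarrow> last (merge f (length xs - 1) xs) = f (last (butlast xs)) (last xs)"
proof -
  assume "i < length xs - 1"
  moreover from this obtain ys x where "xs = ys @ [x]"
    by (cases xs rule: rev_cases) auto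
  ultimately show "last (merge f i xs) = last xs"
    by (cases ys) (auto simp: merge_def)
next
  assume "1 < length xs"
  then obtain ys y x where "xs = ys @ [y, x]"
    by (cases xs rule: rev_cases; cases "butlast xs" rule: rev_cases) auto
  then show "last (merge f (length xs - 1) xs) = f (last (butlast xs)) (last xs)"
    by (simp add: merge_def nth_append butlast_append)
qed

text \<open>\<open>merge_merge\<close> matches the remaining arguments. The law \<open>L\<close>
  settles \<open>i = 0\<close>, \<open>j = 1\<close>; the law \<open>R\<close> settles the last two
  faces; \<open>LR\<close> settles the first face against the last.\<close>

lemma face_face:
  assumes mul: "\<And>x y z. mul (mul x y) z = mul x (mul y z)"
    and L: "\<And>x y m. L (mul x y) m = L x (L y m)"
    and R: "\<And>m x y. R (R m x) y = R m (mul x y)"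
    and LR: "\<And>x m y. R (L x m) y = L x (R m y)"
    and ij: "i < j" "j \<le> length xs" and len: "1 < length xs"
  shows "face mul L R j (face mul L R i G) xs = face mul L R i (face mul L R (j - 1) G) xs"
proof -
  have mm: "merge mul (j - Suc 0) (merge mul i xs) = merge mul i (merge mul j xs)"
    using merge_merge[of mul, OF mul ij] by simp
  have ne: "xs \<noteq> []" and "i < length xs"
    using len ij by auto
  have lens: "length (merge mul i xs) = length xs - 1" "length (merge mul j xs) = length xs - 1"
    using ij by simp_all
  consider "i = 0" "j = 1" | "i = 0" "1 < j" "j < length xs" | "i = 0" "1 < j" "j = length xs"
    | "0 < i" "j < length xs" | "0 < i" "i < length xs - 1" "j = length xs"
    | "0 < i" "i = length xs - 1" "j = length xs"
    using ij by linarith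
  then show ?thesis
  proof cases
    case 1
    then show ?thesis
      using mm lens len hd_merge(2)[OF len, of mul] by (simp add: face_def L) (simp add: merge_simps)
  next
    case 2
    then have "j - Suc 0 < length xs - Suc 0"
      by linarith
    with 2 show ?thesis
      using mm lens hd_merge(1)[of j xs mul] by (simp add: face_def)
  next
    case 3
    then show ?thesis
      using mm lens hd_merge(1)[of j xs mul] last_merge(1)[of 0 xs mul] ne
      by (simp add: face_def LR)
  next
    case 4
    then have "i < length xs - Suc 0" "j - Suc 0 < length xs - Suc 0" "0 < j - Suc 0"
      using ij by linarith+
    with 4 show ?thesis
      using mm lens \<open>i < length xs\<close> by (simp add: face_def)
  next
    case 5
    then show ?thesis
      using mm lens last_merge(1)[of i xs mul] ne \<open>i < length xs\<close> by (simp add: face_def)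
  next
    case 6
    then show ?thesis
      using mm lens len last_merge(2)[OF len, of mul] ne \<open>i < length xs\<close>
      by (simp add: face_def R) (simp add: merge_def)
  qed
qed

section \<open>Cofaces as Hochschild faces\<close>

text \<open>Three carrier types, so that one definition gives the weighted product on the algebra
  and both weighted actions on the representation.\<close>

definition weighted_op ::
  "(trias_op \<Rightarrow> 'x \<Rightarrow> 'y \<Rightarrow> 'z) \<Rightarrow> nat \<times> 'x \<Rightarrow> nat \<times> 'y \<Rightarrow> nat \<times> 'z"
where
  "weighted_op q u v = (max (fst u) (fst v), q (op_of (fst u) (fst v)) (snd u) (snd v))"

text \<open>The eleven axioms correspond to the possible relative orders of three heights.\<close>

lemma weighted_op_assoc:
  assumes "trias_axioms xy xy_z yz x_yz"
  shows "weighted_op xy_z (weighted_op xy u v) w = weighted_op x_yz u (weighted_op yz v w)"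
proof -
  obtain a x b y c z where "u = (a, x)" "v = (b, y)" "w = (c, z)"
    by (metis surj_pair)
  then show ?thesis
    using assms[unfolded trias_axioms_def, rule_format, of x y z]
    by (cases a b rule: linorder_cases; cases b c rule: linorder_cases;
        cases a c rule: linorder_cases)
       (simp_all add: weighted_op_def op_of_def)
qed

text \<open>The value carries the maximum of all heights, because the outer operations compare the
  extreme height with the maximum of the others.\<close>

definition weighted_cochain ::
  "nat \<Rightarrow> ('a, 'm) cochain \<Rightarrow> (nat \<times> 'a) list \<Rightarrow> nat \<times> 'm"
where
  "weighted_cochain d f xs = (max_height (map fst xs), f (tree_of d (map fst xs)) (map snd xs))"

lemma map_fst_merge:
  "i \<le> length xs \<Longrightarrow> map fst (merge (weighted_op p) i xs) = merge max i (map fst xs)"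
  by (auto simp: merge_def weighted_op_def map_tl map_butlast take_map drop_map)

lemma map_snd_merge:
  assumes "i \<le> length xs"
  shows "map snd (merge (weighted_op p) i xs) =
    (if i = 0 then tl (map snd xs)
     else if i < length xs then
       take (i - 1) (map snd xs) @
       [p (op_of (map fst xs ! (i - 1)) (map fst xs ! i)) (map snd xs ! (i - 1)) (map snd xs ! i)] @
       drop (i + 1) (map snd xs)
     else butlast (map snd xs))"
  using assms by (auto simp: merge_def weighted_op_def map_tl map_butlast take_map drop_map)

lemma max_height_merge:
  assumes "0 < i" "i < length hs"
  shows "max_height (merge max i hs) = max_height hs"
proof -
  have "hs = take (i - 1) hs @ [hs ! (i - 1), hs ! i] @ drop (i + 1) hs"
    using assms id_take_nth_drop[of i hs] by (cases i) (auto simp: take_Suc_conv_app_nth)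
  then have "max_height hs = max_height (take (i - 1) hs @ [hs ! (i - 1), hs ! i] @ drop (i + 1) hs)"
    by (rule arg_cong)
  then show ?thesis
    using assms by (simp add: merge_def max.assoc)
qed

lemma tree_of_in_trees: "set hs \<subseteq> {..<d} \<Longrightarrow> tree_of d hs \<in> trees (length hs)"
  by (simp add: trees_def proper_tree_of)

text \<open>\<open>circ_tree_of\<close> identifies the operation and \<open>del_leaf_tree_of\<close>
  the tree. The weights agree since an inner merge keeps the maximum, and an outer face takes the
  maximum with the removed height.\<close>

lemma weighted_coface:
  assumes xs: "set (map fst xs) \<subseteq> {0<..<d}" "length xs = n + 1" and i: "i \<le> n + 1"
  shows "weighted_cochain d (coface p l r n i f) xs =
    face (weighted_op p) (weighted_op l) (weighted_op r) i (weighted_cochain d f) xs"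
proof -
  define hs as where "hs = map fst xs" and "as = map snd xs"
  have len: "length hs = n + 1" "length as = n + 1"
    using xs by (auto simp: hs_def as_def)
  then have ne: "hs \<noteq> []" "as \<noteq> []" "xs \<noteq> []"
    using xs by auto
  have hs: "set hs \<subseteq> {0<..<d}" "set hs \<subseteq> {..<d}"
    using xs(1) by (auto simp: hs_def)
  have circ: "circ i (tree_of d hs) =
      (if i = 0 then op_of (hd hs) (max_height (tl hs))
       else if i < length hs then op_of (hs ! (i - 1)) (hs ! i)
       else op_of (max_height (butlast hs)) (last hs))"
    using circ_tree_of[OF hs(1) ne(1)] i len by simp
  have del: "del_leaf i (tree_of d hs) = tree_of d (merge max i hs)"
    using del_leaf_tree_of[OF hs(2) ne(1)] i len by simp
  have tree: "tree_of d hs \<in> trees (n + 1)"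
    using tree_of_in_trees[OF hs(2)] len by simp
  have fst_merge: "map fst (merge (weighted_op p) i xs) = merge max i hs"
    using map_fst_merge[of i xs p] i xs by (simp add: hs_def)
  note snd_merge = map_snd_merge[of i xs p, folded hs_def as_def]
  have lhs: "weighted_cochain d (coface p l r n i f) xs =
      (max_height hs, coface p l r n i f (tree_of d hs) as)"
    by (simp add: weighted_cochain_def hs_def as_def)
  have inner: "weighted_cochain d f (merge (weighted_op p) i xs) =
      (max_height (merge max i hs), f (tree_of d (merge max i hs)) (map snd (merge (weighted_op p) i xs)))"
    by (simp add: weighted_cochain_def fst_merge)
  have heads: "hd xs = (hd hs, hd as)" "last xs = (last hs, last as)"
    using ne by (auto simp: hs_def as_def hd_map last_map)
  have max_hd: "max (hd hs) (max_height (tl hs)) = max_height hs"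
    using ne by (cases hs) auto
  have max_last: "max (max_height (butlast hs)) (last hs) = max_height hs"
    using ne by (cases hs rule: rev_cases) auto
  consider "i = 0" | "0 < i" "i < n + 1" | "i = n + 1"
    using i by linarith
  then show ?thesis
  proof cases
    case 1
    then show ?thesis
      unfolding lhs face_def inner heads using tree circ del snd_merge len max_hd
      by (simp add: coface_def weighted_op_def merge_simps)
  next
    case 2
    then show ?thesis
      unfolding lhs face_def inner using tree circ del snd_merge len xs max_height_merge[of i hs]
      by (simp add: coface_def)
  next
    case 3
    then have "merge max i hs = butlast hs"
      using len by (simp add: merge_def)
    with 3 show ?thesis
      unfolding lhs face_def inner heads using tree circ del snd_merge len xs max_last
      by (simp add: coface_def weighted_op_def)
  qed
qed

text \<open>\<open>weighted_coface\<close> holds only for lists of the right length with bounded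
  positive heights, so the inner cochain is replaced at the single list where it is
  evaluated.\<close>

lemma face_cong:
  "G (merge mul i xs) = G' (merge mul i xs) \<Longrightarrow> face mul L R i G xs = face mul L R i G' xs"
  by (cases "i = 0") (simp_all add: face_def)

text \<open>Choose heights for the tree, attach them to the arguments and apply
  \<open>face_face\<close> to the weighted elements.\<close>

lemma coface_coface:
  fixes f :: "('a, 'm::ab_group_add) cochain"
  assumes "trias_axioms p p p p" "trias_axioms r r p r" "trias_axioms l r r l" "trias_axioms p l l l"
    and ij: "i < j" "j \<le> n + 2"
  shows "coface p l r (n + 1) j (coface p l r n i f) = coface p l r (n + 1) i (coface p l r n (j - 1) f)"
proof (intro ext)
  fix \<psi> :: ptree and as :: "'a list"
  show "coface p l r (n + 1) j (coface p l r n i f) \<psi> as =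
    coface p l r (n + 1) i (coface p l r n (j - 1) f) \<psi> as"
  proof (cases "\<psi> \<in> trees (n + 2) \<and> length as = n + 2")
    case True
    then obtain d hs where hs: "set hs \<subseteq> {0<..<d}" "tree_of d hs = \<psi>"
      using ex_tree_of[of \<psi>] by (auto simp: trees_def)
    have "set hs \<subseteq> {..<d}"
      using hs(1) by (rule order_trans) auto
    then have "length hs = n + 2"
      using True hs(2) leaves_tree_of[of hs d] by (simp add: trees_def)
    define xs where "xs = zip hs as"
    have xs: "map fst xs = hs" "map snd xs = as" "length xs = n + 2"
      using True \<open>length hs = n + 2\<close> by (simp_all add: xs_def)
    let ?P = "weighted_op p" and ?L = "weighted_op l" and ?R = "weighted_op r"
    have "weighted_cochain d (coface p l r (n + 1) k (coface p l r n k' f)) xs =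
        face ?P ?L ?R k (face ?P ?L ?R k' (weighted_cochain d f)) xs"
      if "k \<le> n + 2" "k' \<le> n + 1" for k k'
    proof -
      have "set (merge max k hs) \<subseteq> {0<..<d}"
        using hs(1) by (intro set_merge) (auto simp: max_def)
      then have "set (map fst (merge ?P k xs)) \<subseteq> {0<..<d}"
        using map_fst_merge[of k xs p] that xs by simp
      then have "weighted_cochain d (coface p l r n k' f) (merge ?P k xs) =
          face ?P ?L ?R k' (weighted_cochain d f) (merge ?P k xs)"
        using that xs by (intro weighted_coface) auto
      then have "face ?P ?L ?R k (weighted_cochain d (coface p l r n k' f)) xs =
          face ?P ?L ?R k (face ?P ?L ?R k' (weighted_cochain d f)) xs"
        by (rule face_cong)
      then show ?thesis
        using that xs hs weighted_coface[of xs d "n + 1" k p l r "coface p l r n k' f"] by simp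
    qed
    moreover have "face ?P ?L ?R j (face ?P ?L ?R i (weighted_cochain d f)) xs =
        face ?P ?L ?R i (face ?P ?L ?R (j - 1) (weighted_cochain d f)) xs"
      using ij xs by (intro face_face weighted_op_assoc assms) auto
    ultimately have "weighted_cochain d (coface p l r (n + 1) j (coface p l r n i f)) xs =
        weighted_cochain d (coface p l r (n + 1) i (coface p l r n (j - 1) f)) xs"
      using ij by simp
    \<comment> \<open>The second components of the weighted values are the two cochain values in
      question.\<close>
    then show ?thesis
      by (simp add: weighted_cochain_def xs hs)
  next
    case False
    then show ?thesis
      by (auto simp: coface_def)
  qed
qed

section \<open>The cochain complex\<close>

lemma linear_comp:
  "Vector_Spaces.linear s1 s2 f \<Longrightarrow> Vector_Spaces.linear s2 s3 g \<Longrightarrow>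
   Vector_Spaces.linear s1 s3 (\<lambda>x. g (f x))"
  by (simp add: Vector_Spaces.linear_iff)

lemma del_leaf_in_trees:
  assumes "\<psi> \<in> trees (n + 1)" "i \<le> n + 1"
  shows "del_leaf i \<psi> \<in> trees n"
proof -
  obtain d hs where hs: "set hs \<subseteq> {0<..<d}" "tree_of d hs = \<psi>"
    using ex_tree_of[of \<psi>] assms by (auto simp: trees_def)
  have hs': "set hs \<subseteq> {..<d}"
    using hs(1) by (rule order_trans) auto
  then have len: "length hs = n + 1"
    using assms hs(2) leaves_tree_of[of hs d] by (simp add: trees_def)
  then have "hs \<noteq> []"
    by auto
  then have "del_leaf i \<psi> = tree_of d (merge max i hs)"
    using del_leaf_tree_of[OF hs', of i] assms(2) len hs(2) by simp
  moreover have "set (merge max i hs) \<subseteq> {..<d}"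
    using hs' by (intro set_merge) auto
  ultimately show ?thesis
    using tree_of_in_trees[of "merge max i hs" d] len assms by simp
qed

section \<open>Cofaces as linear maps between cochain spaces\<close>

lemma multilinearD:
  "multilinear sA sM n g \<Longrightarrow> length as = n \<Longrightarrow> i < n \<Longrightarrow>
   Vector_Spaces.linear sA sM (\<lambda>x. g (as[i := x]))"
  by (simp add: multilinear_def)

lemma multilinear_cong:
  "\<lbrakk>\<And>as. length as = n \<Longrightarrow> h as = g as; multilinear sA sM n g\<rbrakk> \<Longrightarrow> multilinear sA sM n h"
  by (simp add: multilinear_def)

lemma bilinear_mapD:
  assumes "bilinear_map s1 s2 s3 f"
  shows "Vector_Spaces.linear s2 s3 (\<lambda>y. f x y)" "Vector_Spaces.linear s1 s3 (\<lambda>x. f x y)"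
  using assms by (simp_all add: bilinear_map_def)

lemma multilinear_left:
  assumes l: "bilinear_map sA sM sM l" and g: "multilinear sA sM n g"
  shows "multilinear sA sM (n + 1) (\<lambda>as. l (hd as) (g (tl as)))"
  unfolding multilinear_def
proof (intro allI impI)
  fix as :: "'b list" and q
  assume as: "length as = n + 1" "q < n + 1"
  then obtain b bs where bs: "as = b # bs" "length bs = n"
    by (cases as) auto
  show "Vector_Spaces.linear sA sM (\<lambda>x. l (hd (as[q := x])) (g (tl (as[q := x]))))"
  proof (cases q)
    case 0
    then show ?thesis
      using bilinear_mapD(2)[OF l] bs by simp
  next
    case (Suc q')
    then show ?thesis
      using linear_comp[OF multilinearD[OF g bs(2), of q'] bilinear_mapD(1)[OF l, of b]] bs as
      by simp
  qed
qed

lemma multilinear_right: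
  assumes r: "bilinear_map sM sA sM r" and g: "multilinear sA sM n g"
  shows "multilinear sA sM (n + 1) (\<lambda>as. r (g (butlast as)) (last as))"
  unfolding multilinear_def
proof (intro allI impI)
  fix as :: "'c list" and q
  assume as: "length as = n + 1" "q < n + 1"
  then obtain b bs where bs: "as = bs @ [b]" "length bs = n"
    by (cases as rule: rev_cases) auto
  show "Vector_Spaces.linear sA sM (\<lambda>x. r (g (butlast (as[q := x]))) (last (as[q := x])))"
  proof (cases "q = n")
    case True
    then show ?thesis
      using bilinear_mapD(1)[OF r] bs by (simp add: list_update_append)
  next
    case False
    then show ?thesis
      using linear_comp[OF multilinearD[OF g bs(2), of q] bilinear_mapD(2)[OF r, of b]] bs as
      by (simp add: list_update_append)
  qed
qed

lemma multilinear_middle: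
  assumes p: "bilinear_map sA sA sA p" and g: "multilinear sA sM n g" and i: "0 < i" "i \<le> n"
  shows "multilinear sA sM (n + 1)
    (\<lambda>as. g (take (i - 1) as @ [p (as ! (i - 1)) (as ! i)] @ drop (i + 1) as))"
  unfolding multilinear_def
proof (intro allI impI)
  fix as :: "'b list" and q
  assume as: "length as = n + 1" "q < n + 1"
  define bs where "bs = take (i - 1) as @ [p (as ! (i - 1)) (as ! i)] @ drop (i + 1) as"
  have bs: "length bs = n"
    using as i by (simp add: bs_def)
  let ?h = "\<lambda>x. take (i - 1) (as[q := x]) @ [p (as[q := x] ! (i - 1)) (as[q := x] ! i)] @
    drop (i + 1) (as[q := x])"
  \<comment> \<open>Changing argument \<open>q\<close> changes one entry of the contracted list:
    \<open>q\<close> before the product, \<open>i - 1\<close> for either factor,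
    \<open>q - 1\<close> behind it.\<close>
  consider "q < i - 1" | "q = i - 1" | "q = i" | "q > i"
    by linarith
  then show "Vector_Spaces.linear sA sM (\<lambda>x. g (?h x))"
  proof cases
    case 1
    then have "?h x = bs[q := x]" for x
      using as i by (simp add: bs_def list_update_append take_update_swap)
    then show ?thesis
      using multilinearD[OF g bs, of q] 1 i by simp
  next
    case 2
    then have "?h x = bs[i - 1 := p x (as ! i)]" for x
      using as i by (simp add: bs_def list_update_append)
    then show ?thesis
      using linear_comp[OF bilinear_mapD(2)[OF p] multilinearD[OF g bs, of "i - 1"]] i by simp
  next
    case 3
    then have "?h x = bs[i - 1 := p (as ! (i - 1)) x]" for x
      using as i by (simp add: bs_def list_update_append)
    then show ?thesis
      using linear_comp[OF bilinear_mapD(1)[OF p] multilinearD[OF g bs, of "i - 1"]] i by simp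
  next
    case 4
    then have "\<not> q - 1 < i - 1" "q - 1 - (i - 1) = Suc (q - (i + 1))"
      using i by linarith+
    then have "?h x = bs[q - 1 := x]" for x
      using as i 4 by (simp add: bs_def list_update_append drop_update_swap)
    then show ?thesis
      using multilinearD[OF g bs, of "q - 1"] 4 i as by simp
  qed
qed

lemma coface_in_cochains:
  assumes p: "\<And>c. bilinear_map sA sA sA (p c)" and l: "\<And>c. bilinear_map sA sM sM (l c)"
    and r: "\<And>c. bilinear_map sM sA sM (r c)"
    and f: "f \<in> cochains sA sM n" and i: "i \<le> n + 1"
  shows "coface p l r n i f \<in> cochains sA sM (n + 1)"
proof -
  have "multilinear sA sM (n + 1) (coface p l r n i f \<psi>)" if \<psi>: "\<psi> \<in> trees (n + 1)" for \<psi>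
  proof -
    have g: "multilinear sA sM n (f (del_leaf i \<psi>))"
      using f del_leaf_in_trees[OF \<psi> i] by (simp add: cochains_def)
    consider "i = 0" | "0 < i" "i \<le> n" | "i = n + 1"
      using i by linarith
    then show ?thesis
    proof cases
      case 1
      with g show ?thesis
        using \<psi> by (intro multilinear_cong[OF _ multilinear_left[OF l[of "circ i \<psi>"] g]]) (simp add: coface_def)
    next
      case 2
      with g show ?thesis
        using \<psi> by (intro multilinear_cong[OF _ multilinear_middle[OF p[of "circ i \<psi>"] g 2]]) (simp add: coface_def)
    next
      case 3
      with g show ?thesis
        using \<psi> by (intro multilinear_cong[OF _ multilinear_right[OF r[of "circ i \<psi>"] g]]) (simp add: coface_def)
    qed
  qed
  then show ?thesis
    by (auto simp: cochains_def coface_def)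
qed

lemma coface_linear_between:
  assumes p: "\<And>c. bilinear_map sA sA sA (p c)" and l: "\<And>c. bilinear_map sA sM sM (l c)"
    and r: "\<And>c. bilinear_map sM sA sM (r c)" and i: "i \<le> n + 1"
  shows "linear_between (scale_cochain sM) (cochains sA sM n) (cochains sA sM (n + 1))
    (coface p l r n i)"
proof -
  have l': "l c a (x + y) = l c a x + l c a y" "l c a (sM k x) = sM k (l c a x)" for c a k x y
    using bilinear_mapD(1)[OF l, of c a] by (simp_all add: Vector_Spaces.linear_iff)
  have r': "r c (x + y) a = r c x a + r c y a" "r c (sM k x) a = sM k (r c x a)" for c a k x y
    using bilinear_mapD(2)[OF r, of c a] by (simp_all add: Vector_Spaces.linear_iff)
  have "vector_space sM"
    using bilinear_mapD(1)[OF l] by (simp add: Vector_Spaces.linear_iff)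
  then interpret vector_space sM .
  show ?thesis
    using coface_in_cochains[OF p l r _ i]
    by (auto simp: linear_between_def coface_def scale_cochain_def fun_eq_iff l' r')
qed

section \<open>Cochain spaces and the alternating sum of cofaces\<close>

lemma vector_space_scale_cochain:
  assumes "vector_space sM"
  shows "vector_space (scale_cochain sM)"
proof -
  interpret vector_space sM by fact
  show ?thesis
    by unfold_locales
      (auto simp: scale_cochain_def fun_eq_iff scale_right_distrib scale_left_distrib)
qed

lemma subspace_cochains:
  assumes "vector_space sA" "vector_space sM"
  shows "module.subspace (scale_cochain sM) (cochains sA sM n)"
proof -
  interpret A: vector_space sA by fact
  interpret M: vector_space sM by fact
  interpret C: vector_space "scale_cochain sM"
    by (rule vector_space_scale_cochain) fact
  show ?thesis
    using assms
    by (intro C.subspaceI)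
      (auto simp: cochains_def multilinear_def Vector_Spaces.linear_iff scale_cochain_def
        M.scale_right_distrib M.scale_left_commute)
qed

text \<open>In the double sum for the square of the differential, the cosimplicial identity pairs
  the terms with \<open>i < j\<close> with the others, with opposite signs.\<close>

lemma cosimplicial_imp_cochain_complex:
  assumes vs: "vector_space s" and sub: "\<And>n. module.subspace s (C n)"
    and lin: "\<And>n i. i \<le> n + 1 \<Longrightarrow> linear_between s (C n) (C (n + 1)) (D n i)"
    and cosimp: "\<And>n i j x. i < j \<Longrightarrow> j \<le> n + 2 \<Longrightarrow> x \<in> C n \<Longrightarrow>
      D (n + 1) j (D n i x) = D (n + 1) i (D n (j - 1) x)"
  shows "cochain_complex s C (\<lambda>n x. \<Sum>i=0..n+1. s ((-1) ^ i) (D n i x))"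
proof -
  interpret vector_space s by fact
  have in_C: "D n i x \<in> C (n + 1)" if "i \<le> n + 1" "x \<in> C n" for n i x
    using lin[OF that(1)] that(2) by (simp add: linear_between_def)
  have add: "D n i (x + y) = D n i x + D n i y" if "i \<le> n + 1" "x \<in> C n" "y \<in> C n" for n i x y
    using lin[OF that(1)] that(2,3) by (simp add: linear_between_def)
  have scale: "D n i (s c x) = s c (D n i x)" if "i \<le> n + 1" "x \<in> C n" for n i c x
    using lin[OF that(1)] that(2) by (simp add: linear_between_def)
  have zero: "D n i 0 = 0" if "i \<le> n + 1" for n i
    using scale[OF that subspace_0[OF sub], of 0] by simp
  have sum: "D n i (sum g I) = (\<Sum>k\<in>I. D n i (g k))"
    if "finite I" "i \<le> n + 1" "\<And>k. k \<in> I \<Longrightarrow> g k \<in> C n" for n i g and I :: "nat set"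
    using that(1,3)
  proof (induction I rule: finite_induct)
    case (insert k I)
    then show ?case
      using that(2) subspace_sum[OF sub, of I g n] by (simp add: add)
  qed (use zero that in simp)
  have square: "(\<Sum>j=0..n+2. s ((-1) ^ j) (D (n + 1) j (\<Sum>i=0..n+1. s ((-1) ^ i) (D n i x)))) = 0"
    if x: "x \<in> C n" for n x
  proof -
    define F where "F = (\<lambda>(j, i). s ((-1) ^ (j + i)) (D (n + 1) j (D n i x)))"
    let ?U = "{(j, i). j \<le> n + 2 \<and> i \<le> n + 1 \<and> i < j}"
    let ?V = "{(j, i). j \<le> n + 2 \<and> i \<le> n + 1 \<and> j \<le> i}"
    have UV: "{0..n+2} \<times> {0..n+1} = ?U \<union> ?V"
      by auto
    have "finite ({0..n+2} \<times> {0..n+1})"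
      by simp
    then have fin: "finite ?U" "finite ?V"
      unfolding UV by simp_all
    have "(\<Sum>j=0..n+2. s ((-1) ^ j) (D (n + 1) j (\<Sum>i=0..n+1. s ((-1) ^ i) (D n i x)))) =
        (\<Sum>j=0..n+2. \<Sum>i=0..n+1. F (j, i))"
    proof (rule sum.cong[OF refl])
      fix j assume "j \<in> {0..n+2}"
      then have j: "j \<le> n + 1 + 1"
        by simp
      have "D (n + 1) j (\<Sum>i=0..n+1. s ((-1) ^ i) (D n i x)) =
          (\<Sum>i=0..n+1. D (n + 1) j (s ((-1) ^ i) (D n i x)))"
        using j x by (intro sum subspace_scale[OF sub] in_C) auto
      also have "\<dots> = (\<Sum>i=0..n+1. s ((-1) ^ i) (D (n + 1) j (D n i x)))"
        using j x by (intro sum.cong scale in_C) auto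
      finally show "s ((-1) ^ j) (D (n + 1) j (\<Sum>i=0..n+1. s ((-1) ^ i) (D n i x))) =
          (\<Sum>i=0..n+1. F (j, i))"
        by (simp only: F_def prod.case scale_sum_right scale_scale power_add)
    qed
    also have "\<dots> = sum F ({0..n+2} \<times> {0..n+1})"
      by (simp add: sum.cartesian_product del: sum.cl_ivl_Suc)
    also have "\<dots> = sum F ?U + sum F ?V"
      unfolding UV using fin by (intro sum.union_disjoint) auto
    also have "sum F ?U = (\<Sum>v\<in>?V. - F v)"
    \<comment> \<open>The pair \<open>(j, i)\<close> with \<open>i < j\<close> goes to
      \<open>(i, j - 1)\<close>, which lowers the exponent of \<open>-1\<close> by one; the inverse
      sends \<open>(j, i)\<close> with \<open>j \<le> i\<close> to
      \<open>(i + 1, j)\<close>.\<close>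
    proof (rule sum.reindex_bij_witness[where i = "\<lambda>(j, i). (i + 1, j)" and j = "\<lambda>(j, i). (i, j - 1)"])
      fix u assume "u \<in> ?U"
      then obtain j i where u: "u = (Suc j, i)" "Suc j \<le> n + 2" "i < Suc j"
        by (cases u; cases "fst u") auto
      then show "- F (case u of (j, i) \<Rightarrow> (i, j - 1)) = F u"
        using cosimp[of i "Suc j" n x] x by (simp add: F_def add.commute)
    qed auto
    finally show ?thesis
      by (simp add: sum_negf)
  qed
  have "(\<Sum>i=0..n+1. s ((-1) ^ i) (D n i x)) \<in> C (n + 1)" if "x \<in> C n" for n x
    using that by (intro subspace_sum[OF sub] subspace_scale[OF sub] in_C) auto
  then have "linear_between s (C n) (C (n + 1)) (\<lambda>x. \<Sum>i=0..n+1. s ((-1) ^ i) (D n i x))" for n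
    unfolding linear_between_def
    by (auto simp: add scale scale_right_distrib sum.distrib scale_sum_right scale_left_commute
        simp del: sum.cl_ivl_Suc intro!: sum.cong)
  with square show ?thesis
    using vs sub by (simp add: cochain_complex_def del: sum.cl_ivl_Suc)
qed

theorem theorem2p5:
  fixes sA :: "'k::field \<Rightarrow> 'a::ab_group_add \<Rightarrow> 'a"
    and p :: "trias_op \<Rightarrow> 'a \<Rightarrow> 'a \<Rightarrow> 'a"
    and sM :: "'k \<Rightarrow> 'm::ab_group_add \<Rightarrow> 'm"
    and l :: "trias_op \<Rightarrow> 'a \<Rightarrow> 'm \<Rightarrow> 'm"
    and r :: "trias_op \<Rightarrow> 'm \<Rightarrow> 'a \<Rightarrow> 'm"
  assumes "triassociative_algebra sA p"
    and "trias_representation sA p sM l r"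
  shows "(\<forall>n i. i \<le> n + 1 \<longrightarrow>
            linear_between (scale_cochain sM) (cochains sA sM n) (cochains sA sM (n + 1))
              (coface p l r n i)) \<and>
         (\<forall>n i j. i < j \<and> j \<le> n + 2 \<longrightarrow>
            (\<forall>f\<in>cochains sA sM n.
               coface p l r (n + 1) j (coface p l r n i f) =
               coface p l r (n + 1) i (coface p l r n (j - 1) f))) \<and>
         cochain_complex (scale_cochain sM) (cochains sA sM) (coboundary p sM l r)"
proof -
  interpret trias_representation sA p sM l r by fact
  have lin: "linear_between (scale_cochain sM) (cochains sA sM n) (cochains sA sM (n + 1))
      (coface p l r n i)" if "i \<le> n + 1" for n i
    using that by (intro coface_linear_between A.mult_bilinear left_bilinear right_bilinear)
  have cosimp: "coface p l r (n + 1) j (coface p l r n i f) =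
      coface p l r (n + 1) i (coface p l r n (j - 1) f)"
    if "i < j" "j \<le> n + 2" for n i j and f :: "('a, 'm) cochain"
    using that
    by (intro coface_coface A.mult_axioms axioms_left axioms_middle axioms_right)
  have "cochain_complex (scale_cochain sM) (cochains sA sM)
      (\<lambda>n f. \<Sum>i=0..n+1. scale_cochain sM ((-1) ^ i) (coface p l r n i f))"
    by (intro cosimplicial_imp_cochain_complex vector_space_scale_cochain subspace_cochains lin cosimp
        A.vector_space_axioms M.vector_space_axioms)
  moreover have "(\<lambda>n f. \<Sum>i=0..n+1. scale_cochain sM ((-1) ^ i) (coface p l r n i f)) =
      coboundary p sM l r"
    by (intro ext) (simp only: coboundary_def)
  ultimately show ?thesis
    using lin cosimp by simp
qed

end
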